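(* Let $f:\mathbb{R}^N\to\mathbb{R}$ be a convex differentiable function having a unique minimum point $x^*$, and let $f^*=f(x^* )$. Let $W:\mathbb{R}^N\to\mathbb{R}_+$ be a convex continuously differentiable function with conjugate $$V(x)=\sup_{\zeta\in\mathbb{R}^N}\{\langle\zeta,x\rangle-W(\zeta)\},$$ and suppose $W(0)=0$, $V(0)=0$ and $\nabla W(0)=0$. Suppose that differentiable functions $\zeta,x:[0,\infty)\to\mathbb{R}^N$ solve the system $$\dot\zeta(t)=-\nabla f(x(t)),\quad t\ge0,\qquad \zeta(0)=0,$$ $$t\,\dot x(t)+x(t)=\nabla W(\zeta(t)),\quad t\ge0.$$ Then $$f(x(t))-f^*\le\frac{V(x^* )}{t}\qquad\text{for all } t>0 .$$
   Context: $\langle\cdot,\cdot\rangle$ is the standard inner product on $\mathbb{R}^N$ and a dot denotes the derivative in $t$. $V$ takes values in $[0,+\infty]$; the bound is trivial if $V(x^* )=+\infty$. *)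

theory Defs
  imports "HOL-Analysis.Analysis"
begin

(* Extended-real valued, since the supremum may be infinite. *)
definition convex_conjugate :: "('a::real_inner \<Rightarrow> real) \<Rightarrow> 'a \<Rightarrow> ereal" where
  "convex_conjugate W x = (SUP \<zeta>. ereal (\<zeta> \<bullet> x - W \<zeta>))"

end

(* With p the minimum point, the Lyapunov function t (f (x t) - f p) + W (\<zeta> t) - <\<zeta> t, p> has
   along the flow the derivative f (x t) - f p - <grad f (x t), x t - p>, which is nonpositive
   because f is convex, and it vanishes at t = 0.  Young's inequality <\<zeta>, p> - W \<zeta> \<le> V p
   then gives the bound. *)

theory Submission
  imports Defs
begin

text \<open>Chain rule along a curve: the linear map \<open>h \<mapsto> h \<bullet> D\<close> is
  applied to the velocity \<open>u'\<close>. The filter \<open>at t within S\<close> is kept general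
  because the trajectories live on \<open>{0..}\<close> and have only a one-sided derivative at
  0.\<close>

lemma GDERIV_comp_vector_derivative:
  assumes "GDERIV F (u t) :> D" and "(u has_vector_derivative u') (at t within S)"
  shows "((\<lambda>s. F (u s)) has_real_derivative u' \<bullet> D) (at t within S)"
proof -
  have "((\<lambda>s. F (u s)) has_vector_derivative u' \<bullet> D) (at t within S)"
    using vector_derivative_diff_chain_within[OF assms(2), of F "\<lambda>h. h \<bullet> D"] assms(1)
    by (simp add: gderiv_def has_derivative_at_withinI o_def)
  then show ?thesis
    by (simp add: has_real_derivative_iff_has_vector_derivative)
qed

text \<open>Restricting \<open>f\<close> to the line through \<open>a\<close> and \<open>b\<close>
  gives a convex function of one real variable, which lies above its tangent at 0; the chain rule
  identifies the slope there as \<open>(b - a) \<bullet> D\<close>.\<close>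

lemma convex_on_GDERIV_le:
  fixes f :: "'a::real_inner \<Rightarrow> real"
  assumes cvx: "convex_on UNIV f" and grad: "GDERIV f a :> D"
  shows "(b - a) \<bullet> D \<le> f b - f a"
proof -
  define u where "u s = a + s *\<^sub>R (b - a)" for s :: real
  have "convex_on UNIV (\<lambda>s. f (u s))"
  proof (rule convex_onI)
    fix r s t :: real
    assume t: "0 < t" "t < 1"
    have "u ((1 - t) *\<^sub>R r + t *\<^sub>R s) = (1 - t) *\<^sub>R u r + t *\<^sub>R u s"
      by (simp add: u_def algebra_simps)
    then show "f (u ((1 - t) *\<^sub>R r + t *\<^sub>R s)) \<le> (1 - t) * f (u r) + t * f (u s)"
      using convex_onD[OF cvx, of t "u r" "u s"] t by simp
  qed simp
  moreover have "(u has_vector_derivative b - a) (at 0)"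
    unfolding u_def by (auto intro!: derivative_eq_intros)
  then have "((\<lambda>s. f (u s)) has_real_derivative (b - a) \<bullet> D) (at 0)"
    by (rule GDERIV_comp_vector_derivative[rotated]) (simp add: u_def grad)
  \<comment> \<open>The tangent at parameter 0, where \<open>u 0 = a\<close>, is compared with the
    function at parameter 1, where \<open>u 1 = b\<close>.\<close>
  ultimately have "(b - a) \<bullet> D * (1 - 0) \<le> f (u 1) - f (u 0)"
    by (intro convex_on_imp_above_tangent) auto
  then show ?thesis
    by (simp add: u_def)
qed

theorem mainTheorem3:
  fixes f W :: "real ^ 'n \<Rightarrow> real"
    and grad_f grad_W :: "real ^ 'n \<Rightarrow> real ^ 'n"
    and xstar :: "real ^ 'n"
    and fstar :: real
    and V :: "real ^ 'n \<Rightarrow> ereal"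
    and \<zeta> x x' :: "real \<Rightarrow> real ^ 'n"
  assumes f_convex: "convex_on UNIV f"
    and f_grad: "\<And>y. GDERIV f y :> grad_f y"
    and f_unique_min: "\<And>y. is_arg_min f (\<lambda>_. True) y \<longleftrightarrow> y = xstar"
    and fstar: "fstar = f xstar"
    and W_nonneg: "\<And>z. W z \<ge> 0"
    and W_convex: "convex_on UNIV W"
    and W_grad: "\<And>z. GDERIV W z :> grad_W z"
    and W_grad_cont: "continuous_on UNIV grad_W"
    and V: "V = convex_conjugate W"
    and W_0: "W 0 = 0"
    and V_0: "V 0 = 0"
    and grad_W_0: "grad_W 0 = 0"
    and \<zeta>_ode: "\<And>t. t \<ge> 0 \<Longrightarrow>
      (\<zeta> has_vector_derivative - grad_f (x t)) (at t within {0..})"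
    and \<zeta>_0: "\<zeta> 0 = 0"
    and x_deriv: "\<And>t. t \<ge> 0 \<Longrightarrow> (x has_vector_derivative x' t) (at t within {0..})"
    and x_ode: "\<And>t. t \<ge> 0 \<Longrightarrow> t *\<^sub>R x' t + x t = grad_W (\<zeta> t)"
  shows "\<forall>t>0. ereal (f (x t) - fstar) \<le> V xstar / ereal t"
proof (intro allI impI)
  fix t :: real
  assume t: "t > 0"
  define G where "G s = s * (f (x s) - fstar) + (W (\<zeta> s) - \<zeta> s \<bullet> xstar)" for s
  define G' where "G' s = f (x s) - fstar - (x s - xstar) \<bullet> grad_f (x s)" for s
  have G_deriv: "(G has_real_derivative G' s) (at s within {0..})" if s: "s \<ge> 0" for s
  proof -
    have df: "((\<lambda>s. f (x s)) has_real_derivative x' s \<bullet> grad_f (x s)) (at s within {0..})"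
      by (rule GDERIV_comp_vector_derivative[OF f_grad x_deriv[OF s]])
    have dW: "((\<lambda>s. W (\<zeta> s)) has_real_derivative - grad_f (x s) \<bullet> grad_W (\<zeta> s)) (at s within {0..})"
      by (rule GDERIV_comp_vector_derivative[OF W_grad \<zeta>_ode[OF s]])
    have "((\<lambda>s. \<zeta> s \<bullet> xstar) has_vector_derivative - grad_f (x s) \<bullet> xstar) (at s within {0..})"
      by (rule bounded_linear.has_vector_derivative[OF bounded_linear_inner_left \<zeta>_ode[OF s]])
    then have d\<zeta>: "((\<lambda>s. \<zeta> s \<bullet> xstar) has_real_derivative - grad_f (x s) \<bullet> xstar) (at s within {0..})"
      by (simp add: has_real_derivative_iff_has_vector_derivative)
    have "(G has_real_derivative (f (x s) - fstar + s * (x' s \<bullet> grad_f (x s)))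
        + (- grad_f (x s) \<bullet> grad_W (\<zeta> s) - - grad_f (x s) \<bullet> xstar)) (at s within {0..})"
      unfolding G_def by (rule derivative_eq_intros df dW d\<zeta> refl | simp)+
    \<comment> \<open>Replacing \<open>grad_W (\<zeta> s)\<close> by
      \<open>s *\<^sub>R x' s + x s\<close> makes the two terms containing \<open>x' s\<close>
      cancel, so that only \<open>G' s\<close> remains.\<close>
    then show ?thesis
      by (simp add: G'_def x_ode[OF s, symmetric] inner_add inner_diff inner_commute algebra_simps)
  qed
  \<comment> \<open>This is the tangent inequality for \<open>f\<close> based at \<open>x s\<close>
    and evaluated at \<open>xstar\<close>.\<close>
  have G'_nonpos: "G' s \<le> 0" for s
    using convex_on_GDERIV_le[OF f_convex f_grad, of xstar "x s"]
    by (simp add: G'_def fstar inner_diff_left)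
  have "G t \<le> G 0"
  proof (rule DERIV_nonpos_imp_decreasing_open[of 0 t G])
    \<comment> \<open>Two-sided derivatives are required only on the open interval, whose points are
      interior to \<open>{0..}\<close>; at the endpoints continuity is enough.\<close>
    show "\<exists>y. (G has_real_derivative y) (at s) \<and> y \<le> 0" if "0 < s" "s < t" for s
      using G_deriv[of s] G'_nonpos[of s] that at_within_interior[of s "{0..}"] by auto
    show "continuous_on {0..t} G"
      by (rule continuous_on_subset[OF DERIV_continuous_on[OF G_deriv]]) auto
  qed (simp add: t less_imp_le)
  \<comment> \<open>\<open>G 0 = 0\<close>: the factor \<open>s\<close> kills the first term, and
    \<open>\<zeta> 0 = 0\<close> with \<open>W 0 = 0\<close> kills the rest.\<close>
  then have "t * (f (x t) - fstar) \<le> \<zeta> t \<bullet> xstar - W (\<zeta> t)"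
    by (simp add: G_def \<zeta>_0 W_0)
  \<comment> \<open>The point \<open>\<zeta> t\<close> is one competitor in the supremum defining
    \<open>V xstar\<close>; the comparison takes place in \<open>ereal\<close>, so it covers an
    infinite value too.\<close>
  also have "ereal (\<zeta> t \<bullet> xstar - W (\<zeta> t)) \<le> V xstar"
    unfolding V convex_conjugate_def by (rule SUP_upper) simp
  finally show "ereal (f (x t) - fstar) \<le> V xstar / ereal t"
    using t by (simp add: ereal_le_divide_pos)
qed

end
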